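(* Let $\mathcal{Z}=\mathbb{R}^r$ and $\mathcal{X}=\mathbb{R}^N$, and let $e\in C^1(\mathcal{X},\mathcal{Z})$ (encoder) and $d\in C^1(\mathcal{Z},\mathcal{X})$ (decoder) satisfy $e(d(\zeta))=\zeta$ for all $\zeta\in\mathcal{Z}$. Put $\tilde{\mathcal{X}}:=d(\mathcal{Z})\subset\mathcal{X}$. Assume a nonlinear port-Hamiltonian system on $\mathcal{Z}$ with data $(J,R,B,\mathcal{H})$ is given (see context), with input signal $u:\mathcal{T}\to\mathbb{R}^p$, initial value $z_0$, solution trajectory $z(t)\in\mathcal{Z}$ and output $y(t)\in\mathbb{R}^p$, $t\in\mathcal{T}$. Then the reconstructed trajectory $\tilde x(t):=d(z(t))\in\tilde{\mathcal{X}}$ is a solution of the nonlinear port-Hamiltonian system on $\tilde{\mathcal{X}}$ $$\dot{\tilde x}(t)=\big(\bar J(\tilde x(t))-\bar R(\tilde x(t))\big)\nabla\bar{\mathcal{H}}(\tilde x(t))+\bar B(\tilde x(t))\,u(t),\qquad \tilde x(0)=\tilde x_0,$$ $$\bar y(t)=\bar B(\tilde x(t))^{\top}\nabla\bar{\mathcal{H}}(\tilde x(t)),$$ with matrices defined, at $\xi=d(\zeta)\in\tilde{\mathcal{X}}$ with $\zeta\in\mathcal{Z}$, by $$\bar J(\xi):=Dd(\zeta)\,J(\zeta)\,Dd(\zeta)^{\top},\qquad \bar R(\xi):=Dd(\zeta)\,R(\zeta)\,Dd(\zeta)^{\top},\qquad \bar B(\xi):=Dd(\zeta)\,B(\zeta),$$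 (which satisfy $\bar J(\xi)=-\bar J(\xi)^{\top}$ and $\bar R(\xi)=\bar R(\xi)^{\top}\succeq0$ for all $\xi\in\tilde{\mathcal{X}}$), with the reconstructed Hamiltonian $\bar{\mathcal{H}}:=\mathcal{H}\circ e$, the reconstructed initial value $\tilde x_0:=d(z_0)$, and output $\bar y(t)=y(t)$ for all $t\in\mathcal{T}$.
   Context: $\mathcal{T}=[0,t_{\mathrm{end}}]$ with $t_{\mathrm{end}}>0$. $Dd(\zeta)\in\mathbb{R}^{N\times r}$ denotes the Jacobian matrix of $d$ at $\zeta$; gradients are with respect to the Euclidean coordinates of $\mathbb{R}^r$ and $\mathbb{R}^N$ respectively. A nonlinear port-Hamiltonian (pH) system on $\mathcal{Z}$ consists of a differentiable function $\mathcal{H}:\mathcal{Z}\to\mathbb{R}$ (the Hamiltonian) and continuous maps $J,R:\mathcal{Z}\to\mathbb{R}^{r\times r}$, $B:\mathcal{Z}\to\mathbb{R}^{r\times p}$ with $J(\zeta)=-J(\zeta)^{\top}$ and $R(\zeta)=R(\zeta)^{\top}\succeq 0$ for all $\zeta\in\mathcal{Z}$; it is the initial value problem with output $$\dot z(t)=\big(J(z(t))-R(z(t))\big)\nabla\mathcal{H}(z(t))+B(z(t))\,u(t),\quad z(0)=z_0,\qquad y(t)=B(z(t))^{\top}\nabla\mathcal{H}(z(t)).$$ A pH system on the subset $\tilde{\mathcal{X}}\subset\mathcal{X}=\mathbb{R}^N$ is of the same form, with matrix-valued maps defined on $\tilde{\mathcal{X}}$ having these pointwise properties at every point of $\tilde{\mathcal{X}}$,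 and with trajectories in $\tilde{\mathcal{X}}$; the gradient of its Hamiltonian is taken in $\mathbb{R}^N$. A solution is a differentiable function of $t\in\mathcal{T}$ satisfying the equations for all $t\in\mathcal{T}$. *)

theory Defs
  imports "HOL-Analysis.Analysis"
begin

definition C1_map :: "(real ^ 'm \<Rightarrow> real ^ 'k) \<Rightarrow> bool" where
  "C1_map f \<longleftrightarrow>
     (\<forall>x. f differentiable (at x)) \<and> continuous_on UNIV (\<lambda>x. jacobian f (at x))"

(* Total function; meaningful only where H is differentiable. *)
definition gradient :: "(real ^ 'm \<Rightarrow> real) \<Rightarrow> real ^ 'm \<Rightarrow> real ^ 'm" where
  "gradient H x = (THE g. GDERIV H x :> g)"

definition positive_semidefinite :: "real ^ 'm ^ 'm \<Rightarrow> bool" where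
  "positive_semidefinite A \<longleftrightarrow> (\<forall>v. 0 \<le> v \<bullet> (A *v v))"

(* Data of a port-Hamiltonian system on a subset S of the Euclidean space. The values of J, R, B
   outside S are irrelevant. The Hamiltonian is differentiable, and its gradient is taken, in
   the ambient space, so S need not be open. *)
definition port_hamiltonian_on ::
  "(real ^ 'm) set \<Rightarrow> (real ^ 'm \<Rightarrow> real ^ 'm ^ 'm) \<Rightarrow> (real ^ 'm \<Rightarrow> real ^ 'm ^ 'm) \<Rightarrow>
   (real ^ 'm \<Rightarrow> real ^ 'p ^ 'm) \<Rightarrow> (real ^ 'm \<Rightarrow> real) \<Rightarrow> bool" where
  "port_hamiltonian_on S J R B H \<longleftrightarrow>
     (\<forall>x\<in>S. H differentiable (at x)) \<and>
     continuous_on S J \<and> continuous_on S R \<and> continuous_on S B \<and>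
     (\<forall>x\<in>S. J x = - transpose (J x)) \<and>
     (\<forall>x\<in>S. R x = transpose (R x) \<and> positive_semidefinite (R x))"

(* One-sided derivatives at the end points of the time interval. *)
definition ph_solution ::
  "real \<Rightarrow> (real ^ 'm) set \<Rightarrow> (real ^ 'm \<Rightarrow> real ^ 'm ^ 'm) \<Rightarrow> (real ^ 'm \<Rightarrow> real ^ 'm ^ 'm) \<Rightarrow>
   (real ^ 'm \<Rightarrow> real ^ 'p ^ 'm) \<Rightarrow> (real ^ 'm \<Rightarrow> real) \<Rightarrow>
   (real \<Rightarrow> real ^ 'p) \<Rightarrow> real ^ 'm \<Rightarrow> (real \<Rightarrow> real ^ 'm) \<Rightarrow> bool" where
  "ph_solution t\<^sub>e S J R B H u x\<^sub>0 x \<longleftrightarrow>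
     (\<forall>t\<in>{0..t\<^sub>e}. x t \<in> S \<and>
        (x has_vector_derivative
           (J (x t) - R (x t)) *v gradient H (x t) + B (x t) *v u t) (at t within {0..t\<^sub>e})) \<and>
     x 0 = x\<^sub>0"

definition ph_output ::
  "(real ^ 'm \<Rightarrow> real ^ 'p ^ 'm) \<Rightarrow> (real ^ 'm \<Rightarrow> real) \<Rightarrow> (real \<Rightarrow> real ^ 'm) \<Rightarrow> real \<Rightarrow> real ^ 'p" where
  "ph_output B H x t = transpose (B (x t)) *v gradient H (x t)"

(* Matrix fields on the image of an injective decoder d: the point zeta below is the unique one with
   d zeta = xi. The values outside the range of d are unspecified. *)
definition reconstruct_matrix ::
  "(real ^ 'r \<Rightarrow> real ^ 'n) \<Rightarrow> (real ^ 'r \<Rightarrow> real ^ 'r ^ 'r) \<Rightarrow> real ^ 'n \<Rightarrow> real ^ 'n ^ 'n" where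
  "reconstruct_matrix d M \<xi> =
     (let \<zeta> = (THE \<zeta>. d \<zeta> = \<xi>); D = jacobian d (at \<zeta>) in D ** M \<zeta> ** transpose D)"

definition reconstruct_port ::
  "(real ^ 'r \<Rightarrow> real ^ 'n) \<Rightarrow> (real ^ 'r \<Rightarrow> real ^ 'p ^ 'r) \<Rightarrow> real ^ 'n \<Rightarrow> real ^ 'p ^ 'n" where
  "reconstruct_port d B \<xi> = (let \<zeta> = (THE \<zeta>. d \<zeta> = \<xi>) in jacobian d (at \<zeta>) ** B \<zeta>)"

end

theory Submission
  imports Defs
begin

text \<open>
  The decoder embeds the latent state space in the large one, and the encoder is a left inverse
  of it.  The Hamiltonian \<open>H \<circ> e\<close> on the image of \<open>d\<close> therefore pulls back to the original one:
  \<open>(H \<circ> e) \<circ> d = H\<close>.  Differentiating this identity with the chain rule gives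
  \<open>Dd(\<zeta>)\<^sup>T \<nabla>(H \<circ> e)(d \<zeta>) = \<nabla>H(\<zeta>)\<close> (lemma \<open>transpose_jacobian_gradient_encoded\<close>), and this is all
  that the dynamics need.  Both \<open>Dd J Dd\<^sup>T\<close> and \<open>Dd R Dd\<^sup>T\<close> apply \<open>Dd\<^sup>T\<close> first,
  so applying \<open>Dd J Dd\<^sup>T - Dd R Dd\<^sup>T\<close> to the reconstructed gradient yields \<open>Dd (J - R) \<nabla>H\<close>; adding
  \<open>Dd B u\<close> yields \<open>Dd(z) z'\<close>, which is the derivative of \<open>d \<circ> z\<close>.  In the same way
  \<open>(Dd B)\<^sup>T \<nabla>(H \<circ> e) = B\<^sup>T \<nabla>H\<close>, so that the outputs agree.

  The structural properties hold because a congruence \<open>M \<mapsto> D M D\<^sup>T\<close> preserves skew-symmetry,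
  symmetry and positive semidefiniteness.  Continuity of the reconstructed matrices on the image
  of \<open>d\<close> follows since there the parameter \<open>\<zeta>\<close> of a point \<open>\<xi>\<close> is \<open>e \<xi>\<close>, and \<open>e\<close> and \<open>Dd\<close> are continuous.
\<close>

section \<open>Gradients and the chain rule\<close>

lemma inner_transpose_matrix_vector:
  fixes A :: "real ^ 'n ^ 'm"
  shows "x \<bullet> (transpose A *v y) = (A *v x) \<bullet> y"
  by (metis dot_lmul_matrix inner_commute transpose_matrix_vector)

lemma GDERIV_gradient_eq:
  assumes "GDERIV H x :> g"
  shows "gradient H x = g"
  unfolding gradient_def
proof (rule the_equality)
  fix g' assume "GDERIV H x :> g'"
  with assms have "(\<lambda>h. h \<bullet> g') = (\<lambda>h. h \<bullet> g)"
    unfolding gderiv_def by (rule has_derivative_unique[rotated])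
  then show "g' = g"
    by (metis vector_eq_ldot)
qed (rule assms)

text \<open>The gradient is the Riesz representative of the derivative, which the adjoint evaluated at
  the number 1 provides.\<close>

lemma differentiable_GDERIV_gradient:
  assumes "H differentiable (at x)"
  shows "GDERIV H x :> gradient H x"
proof -
  from assms obtain H' where H': "(H has_derivative H') (at x)"
    unfolding differentiable_def by blast
  \<comment> \<open>Naming the vector keeps \<open>H'\<close> out of the right-hand side of the rewrite rule below.\<close>
  obtain g where "g = adjoint H' 1"
    by blast
  then have "H' = (\<lambda>h. h \<bullet> g)"
    using adjoint_works[OF has_derivative_linear[OF H'], of _ 1] by (intro ext) simp
  with H' have "GDERIV H x :> g"
    by (simp add: gderiv_def)
  then show ?thesis
    by (simp add: GDERIV_gradient_eq)
qed

lemma gradient_compose: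
  assumes "f differentiable (at x)" and "H differentiable (at (f x))"
  shows "gradient (H \<circ> f) x = transpose (jacobian f (at x)) *v gradient H (f x)"
proof (rule GDERIV_gradient_eq)
  have "(H \<circ> f has_derivative (\<lambda>h. h \<bullet> gradient H (f x)) \<circ> (\<lambda>h. jacobian f (at x) *v h)) (at x)"
    using assms differentiable_GDERIV_gradient
    by (intro diff_chain_at) (simp_all add: gderiv_def flip: jacobian_works)
  then show "GDERIV (H \<circ> f) x :> transpose (jacobian f (at x)) *v gradient H (f x)"
    unfolding gderiv_def inner_transpose_matrix_vector o_def .
qed

text \<open>The identity that carries the theorem: the chain rule for \<open>(H \<circ> e) \<circ> d = H\<close>.\<close>

lemma transpose_jacobian_gradient_encoded:
  assumes left_inverse: "\<And>\<zeta>. e (d \<zeta>) = \<zeta>"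
    and d: "d differentiable (at \<zeta>)"
    and He: "(H \<circ> e) differentiable (at (d \<zeta>))"
  shows "transpose (jacobian d (at \<zeta>)) *v gradient (H \<circ> e) (d \<zeta>) = gradient H \<zeta>"
proof -
  have "(H \<circ> e) \<circ> d = H"
    using left_inverse by (simp add: fun_eq_iff)
  then show ?thesis
    using gradient_compose[OF d He] by metis
qed

section \<open>Congruence transformations of matrices\<close>

lemma skew_congruence:
  fixes D :: "real ^ 'r ^ 'n"
  assumes "M = - transpose M"
  shows "D ** M ** transpose D = - transpose (D ** M ** transpose D)"
proof -
  have "D ** (- M) ** transpose D = - (D ** M ** transpose D)"
    by (simp add: vec_eq_iff matrix_matrix_mult_def sum_negf)
  moreover have "transpose (D ** M ** transpose D) = D ** transpose M ** transpose D"
    by (simp add: matrix_transpose_mul matrix_mul_assoc)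
  moreover have "transpose M = - M"
    using assms by (metis minus_minus)
  ultimately show ?thesis
    by simp
qed

lemma symmetric_congruence:
  fixes D :: "real ^ 'r ^ 'n"
  assumes "M = transpose M"
  shows "D ** M ** transpose D = transpose (D ** M ** transpose D)"
  using assms by (simp add: matrix_transpose_mul matrix_mul_assoc)

lemma positive_semidefinite_congruence:
  fixes D :: "real ^ 'r ^ 'n"
  assumes "positive_semidefinite M"
  shows "positive_semidefinite (D ** M ** transpose D)"
  unfolding positive_semidefinite_def
proof
  fix v
  have "v \<bullet> ((D ** M ** transpose D) *v v) = (transpose D *v v) \<bullet> (M *v (transpose D *v v))"
    using inner_transpose_matrix_vector[of v "transpose D"]
    by (simp flip: matrix_vector_mul_assoc)
  then show "0 \<le> v \<bullet> ((D ** M ** transpose D) *v v)"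
    using assms by (simp add: positive_semidefinite_def)
qed

lemma continuous_on_matrix_mult:
  fixes F :: "'a::topological_space \<Rightarrow> real ^ 'k ^ 'm" and G :: "'a \<Rightarrow> real ^ 'n ^ 'k"
  assumes "continuous_on S F" and "continuous_on S G"
  shows "continuous_on S (\<lambda>x. F x ** G x)"
  unfolding matrix_matrix_mult_def by (intro continuous_intros assms)

lemma continuous_on_transpose:
  fixes F :: "'a::topological_space \<Rightarrow> real ^ 'n ^ 'm"
  assumes "continuous_on S F"
  shows "continuous_on S (\<lambda>x. transpose (F x))"
  unfolding transpose_def by (intro continuous_intros assms)

section \<open>Reconstruction along a decoder with a left inverse\<close>

lemma the_preimage_left_inverse:
  assumes "\<And>\<zeta>. e (d \<zeta>) = \<zeta>"
  shows "(THE \<zeta>'. d \<zeta>' = d \<zeta>) = \<zeta>"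
  using assms by (intro the_equality) (auto, metis)

lemma reconstruct_matrix_decoder:
  assumes "\<And>\<zeta>. e (d \<zeta>) = \<zeta>"
  shows "reconstruct_matrix d M (d \<zeta>) = jacobian d (at \<zeta>) ** M \<zeta> ** transpose (jacobian d (at \<zeta>))"
  by (simp add: reconstruct_matrix_def Let_def the_preimage_left_inverse[of e, OF assms])

lemma reconstruct_port_decoder:
  assumes "\<And>\<zeta>. e (d \<zeta>) = \<zeta>"
  shows "reconstruct_port d B (d \<zeta>) = jacobian d (at \<zeta>) ** B \<zeta>"
  by (simp add: reconstruct_port_def Let_def the_preimage_left_inverse[of e, OF assms])

text \<open>A map on the image of \<open>d\<close> is continuous as soon as its pullback to the latent space is,
  because the encoder is a continuous choice of the parameter.\<close>

lemma continuous_on_range_decoder: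
  assumes left_inverse: "\<And>\<zeta>. e (d \<zeta>) = \<zeta>"
    and e: "continuous_on UNIV e"
    and pullback: "continuous_on UNIV (\<lambda>\<zeta>. F (d \<zeta>))"
  shows "continuous_on (range d) F"
proof -
  have "continuous_on (range d) (\<lambda>\<xi>. F (d (e \<xi>)))"
    using continuous_on_compose2[OF pullback continuous_on_subset[OF e]] by simp
  then show ?thesis
    by (rule continuous_on_eq) (auto simp: left_inverse)
qed

lemma C1_map_differentiable: "C1_map f \<Longrightarrow> f differentiable (at x)"
  by (simp add: C1_map_def)

lemma C1_map_continuous_on: "C1_map f \<Longrightarrow> continuous_on UNIV f"
  by (meson C1_map_differentiable continuous_at_imp_continuous_on differentiable_imp_continuous_within)

lemma encoded_hamiltonian_differentiable:
  assumes "\<And>\<zeta>. e (d \<zeta>) = \<zeta>" and "C1_map e" and "H differentiable (at \<zeta>)"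
  shows "(H \<circ> e) differentiable (at (d \<zeta>))"
  using assms by (intro differentiable_chain_at) (simp_all add: C1_map_differentiable)

lemma port_hamiltonian_on_reconstruct:
  assumes left_inverse: "\<And>\<zeta>. e (d \<zeta>) = \<zeta>"
    and e: "C1_map e" and d: "C1_map d"
    and ph: "port_hamiltonian_on UNIV J R B H"
  shows "port_hamiltonian_on (range d)
           (reconstruct_matrix d J) (reconstruct_matrix d R) (reconstruct_port d B) (H \<circ> e)"
proof -
  have Dd: "continuous_on UNIV (\<lambda>\<zeta>. jacobian d (at \<zeta>))"
    using d by (simp add: C1_map_def)
  note rec = reconstruct_matrix_decoder[of e d, OF left_inverse]
    reconstruct_port_decoder[of e d, OF left_inverse]
  note cont = continuous_on_range_decoder[of e d, OF left_inverse C1_map_continuous_on[OF e]]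
  have matrix: "continuous_on (range d) (reconstruct_matrix d M)" if "continuous_on UNIV M" for M
    by (rule cont) (simp add: rec that Dd continuous_on_matrix_mult continuous_on_transpose)
  have port: "continuous_on (range d) (reconstruct_port d B)"
    using ph by (intro cont) (simp add: rec Dd port_hamiltonian_on_def continuous_on_matrix_mult)
  show ?thesis
    unfolding port_hamiltonian_on_def
  proof (intro conjI ballI)
    show "continuous_on (range d) (reconstruct_matrix d J)"
      "continuous_on (range d) (reconstruct_matrix d R)"
      using ph by (simp_all add: matrix port_hamiltonian_on_def)
    show "continuous_on (range d) (reconstruct_port d B)"
      by (fact port)
  next
    fix \<xi> assume "\<xi> \<in> range d"
    then obtain \<zeta> where \<xi>: "\<xi> = d \<zeta>"
      by blast
    from ph have H: "H differentiable (at \<zeta>)" and J: "J \<zeta> = - transpose (J \<zeta>)"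
      and R: "R \<zeta> = transpose (R \<zeta>)" "positive_semidefinite (R \<zeta>)"
      by (simp_all add: port_hamiltonian_on_def)
    show "(H \<circ> e) differentiable (at \<xi>)"
      unfolding \<xi> using left_inverse e H by (rule encoded_hamiltonian_differentiable)
    show "reconstruct_matrix d J \<xi> = - transpose (reconstruct_matrix d J \<xi>)"
      unfolding \<xi> rec using J by (rule skew_congruence)
    show "reconstruct_matrix d R \<xi> = transpose (reconstruct_matrix d R \<xi>)"
      unfolding \<xi> rec using R(1) by (rule symmetric_congruence)
    show "positive_semidefinite (reconstruct_matrix d R \<xi>)"
      unfolding \<xi> rec using R(2) by (rule positive_semidefinite_congruence)
  qed
qed

text \<open>The reconstructed vector field is the pushforward of the latent one under \<open>Dd\<close>.\<close>

lemma reconstructed_vector_field: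
  assumes left_inverse: "\<And>\<zeta>. e (d \<zeta>) = \<zeta>"
    and e: "C1_map e" and d: "C1_map d"
    and H: "H differentiable (at \<zeta>)"
  shows "(reconstruct_matrix d J (d \<zeta>) - reconstruct_matrix d R (d \<zeta>)) *v gradient (H \<circ> e) (d \<zeta>)
           + reconstruct_port d B (d \<zeta>) *v v
         = jacobian d (at \<zeta>) *v ((J \<zeta> - R \<zeta>) *v gradient H \<zeta> + B \<zeta> *v v)"
proof -
  have "transpose (jacobian d (at \<zeta>)) *v gradient (H \<circ> e) (d \<zeta>) = gradient H \<zeta>"
    using left_inverse C1_map_differentiable[OF d]
      encoded_hamiltonian_differentiable[of e d, OF left_inverse e H]
    by (rule transpose_jacobian_gradient_encoded)
  then show ?thesis
    by (simp add: reconstruct_matrix_decoder[of e d, OF left_inverse]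
        reconstruct_port_decoder[of e d, OF left_inverse]
        matrix_vector_mult_diff_rdistrib matrix_vector_mult_diff_distrib
        matrix_vector_right_distrib flip: matrix_vector_mul_assoc)
qed

lemma ph_solution_reconstruct:
  assumes left_inverse: "\<And>\<zeta>. e (d \<zeta>) = \<zeta>"
    and e: "C1_map e" and d: "C1_map d"
    and H: "\<And>\<zeta>. H differentiable (at \<zeta>)"
    and z: "ph_solution t\<^sub>e UNIV J R B H u z\<^sub>0 z"
  shows "ph_solution t\<^sub>e (range d)
           (reconstruct_matrix d J) (reconstruct_matrix d R) (reconstruct_port d B) (H \<circ> e)
           u (d z\<^sub>0) (d \<circ> z)"
proof -
  have "((d \<circ> z) has_vector_derivative jacobian d (at (z t)) *v
           ((J (z t) - R (z t)) *v gradient H (z t) + B (z t) *v u t)) (at t within {0..t\<^sub>e})"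
    if "t \<in> {0..t\<^sub>e}" for t
  proof (rule vector_derivative_diff_chain_within)
    show "(z has_vector_derivative (J (z t) - R (z t)) *v gradient H (z t) + B (z t) *v u t)
            (at t within {0..t\<^sub>e})"
      using z that by (simp add: ph_solution_def)
    show "(d has_derivative (\<lambda>h. jacobian d (at (z t)) *v h)) (at (z t) within z ` {0..t\<^sub>e})"
      using C1_map_differentiable[OF d]
      by (simp add: jacobian_works has_derivative_at_withinI)
  qed
  then show ?thesis
    using z by (simp add: ph_solution_def reconstructed_vector_field[of e d, OF left_inverse e d H])
qed

lemma ph_output_reconstruct:
  assumes left_inverse: "\<And>\<zeta>. e (d \<zeta>) = \<zeta>"
    and e: "C1_map e" and d: "C1_map d"
    and H: "H differentiable (at (z t))"
  shows "ph_output (reconstruct_port d B) (H \<circ> e) (d \<circ> z) t = ph_output B H z t"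
proof -
  have "transpose (jacobian d (at (z t))) *v gradient (H \<circ> e) (d (z t)) = gradient H (z t)"
    using left_inverse C1_map_differentiable[OF d]
      encoded_hamiltonian_differentiable[of e d, OF left_inverse e H]
    by (rule transpose_jacobian_gradient_encoded)
  then show ?thesis
    by (simp add: ph_output_def reconstruct_port_decoder[of e d, OF left_inverse]
        matrix_transpose_mul flip: matrix_vector_mul_assoc)
qed

theorem theorem3:
  fixes e :: "real ^ 'n \<Rightarrow> real ^ 'r"
    and d :: "real ^ 'r \<Rightarrow> real ^ 'n"
    and J R :: "real ^ 'r \<Rightarrow> real ^ 'r ^ 'r"
    and B :: "real ^ 'r \<Rightarrow> real ^ 'p ^ 'r"
    and H :: "real ^ 'r \<Rightarrow> real"
    and t_end :: real
    and u :: "real \<Rightarrow> real ^ 'p"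
    and z\<^sub>0 :: "real ^ 'r"
    and z :: "real \<Rightarrow> real ^ 'r"
    and y :: "real \<Rightarrow> real ^ 'p"
  defines "Jbar \<equiv> reconstruct_matrix d J"
    and "Rbar \<equiv> reconstruct_matrix d R"
    and "Bbar \<equiv> reconstruct_port d B"
    and "Hbar \<equiv> H \<circ> e"
    and "xtilde \<equiv> d \<circ> z"
  assumes "t_end > 0"
    and "C1_map e" and "C1_map d"
    and "\<And>\<zeta>. e (d \<zeta>) = \<zeta>"
    and "port_hamiltonian_on UNIV J R B H"
    and "ph_solution t_end UNIV J R B H u z\<^sub>0 z"
    and "\<And>t. t \<in> {0..t_end} \<Longrightarrow> y t = ph_output B H z t"
  shows "(\<forall>\<zeta>. Jbar (d \<zeta>) = jacobian d (at \<zeta>) ** J \<zeta> ** transpose (jacobian d (at \<zeta>)) \<and>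
              Rbar (d \<zeta>) = jacobian d (at \<zeta>) ** R \<zeta> ** transpose (jacobian d (at \<zeta>)) \<and>
              Bbar (d \<zeta>) = jacobian d (at \<zeta>) ** B \<zeta>) \<and>
         port_hamiltonian_on (range d) Jbar Rbar Bbar Hbar \<and>
         ph_solution t_end (range d) Jbar Rbar Bbar Hbar u (d z\<^sub>0) xtilde \<and>
         (\<forall>t\<in>{0..t_end}. ph_output Bbar Hbar xtilde t = y t)"
proof -
  note left_inverse = \<open>\<And>\<zeta>. e (d \<zeta>) = \<zeta>\<close> and e = \<open>C1_map e\<close> and d = \<open>C1_map d\<close>
  note ph = \<open>port_hamiltonian_on UNIV J R B H\<close>
  have H: "H differentiable (at \<zeta>)" for \<zeta>
    using ph by (simp add: port_hamiltonian_on_def)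
  have "\<forall>\<zeta>. Jbar (d \<zeta>) = jacobian d (at \<zeta>) ** J \<zeta> ** transpose (jacobian d (at \<zeta>)) \<and>
            Rbar (d \<zeta>) = jacobian d (at \<zeta>) ** R \<zeta> ** transpose (jacobian d (at \<zeta>)) \<and>
            Bbar (d \<zeta>) = jacobian d (at \<zeta>) ** B \<zeta>"
    unfolding Jbar_def Rbar_def Bbar_def
    using reconstruct_matrix_decoder[of e d, OF left_inverse]
      reconstruct_port_decoder[of e d, OF left_inverse] by blast
  moreover have "port_hamiltonian_on (range d) Jbar Rbar Bbar Hbar"
    unfolding Jbar_def Rbar_def Bbar_def Hbar_def
    using left_inverse e d ph by (rule port_hamiltonian_on_reconstruct)
  moreover have "ph_solution t_end (range d) Jbar Rbar Bbar Hbar u (d z\<^sub>0) xtilde"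
    unfolding Jbar_def Rbar_def Bbar_def Hbar_def xtilde_def
    using left_inverse e d H \<open>ph_solution t_end UNIV J R B H u z\<^sub>0 z\<close>
    by (rule ph_solution_reconstruct)
  moreover have "\<forall>t\<in>{0..t_end}. ph_output Bbar Hbar xtilde t = y t"
    unfolding Bbar_def Hbar_def xtilde_def
    using ph_output_reconstruct[of e d, OF left_inverse e d H]
      \<open>\<And>t. t \<in> {0..t_end} \<Longrightarrow> y t = ph_output B H z t\<close> by metis
  ultimately show ?thesis
    by blast
qed

end
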